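(* Let $K$ be a kernel on $\mathbb{R}^m$ satisfying (k1) and (k2). Suppose that for every $u\in U$ the function $F(u,\cdot)$ is continuously differentiable and its gradient $\nabla F(u,x)$ (with respect to $x$) has a modulus of continuity of the form $$\|\nabla F(u,x+y)-\nabla F(u,x)\|\le\sum_{j=1}^{\ell}L_j\|y\|^{\alpha_j}\qquad\text{for all }u\in U,\ x,y\in\mathbb{R}^m,$$ with $\ell\ge1$, $L_j\ge0$ and $\alpha_j\in(0,1]$. Then there exist constants $\alpha\in(0,1]$ and $L>0$ such that for bandwidth $h_N<1$ we have $$\big|\theta_K^{(N)}-\theta\big|\le\big|\theta_{SAA}^{(N)}-\theta\big|+Lh_N^{1+\alpha}\quad\text{almost surely},$$ $$\big|\mathbb{E}[\theta_K^{(N)}]-\theta\big|\le\big|\mathbb{E}[\theta_{SAA}^{(N)}]-\theta\big|+Lh_N^{1+\alpha},$$ $$\Big(\mathbb{E}\big[(\theta_K^{(N)}-\mathbb{E}[\theta_K^{(N)}])^2\big]\Big)^{1/2}\le\Big(\mathbb{E}\big[(\theta_{SAA}^{(N)}-\mathbb{E}[\theta_{SAA}^{(N)}])^2\big]\Big)^{1/2}+2Lh_N^{1+\alpha},$$ $$\Big(\mathbb{E}\big[(\theta_K^{(N)}-\theta)^2\big]\Big)^{1/2}\le\Big(\mathbb{E}\big[(\theta_{SAA}^{(N)}-\theta)^2\big]\Big)^{1/2}+Lh_N^{1+\alpha}.$$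
   Context: $U\subset\mathbb{R}^n$ is nonempty and closed. $X$ is an integrable random vector with values in $\mathbb{R}^m$, and $F:\mathbb{R}^n\times\mathbb{R}^m\to\mathbb{R}$ is sufficiently regular that $\mathbb{E}[F(u,X)]$ is well defined and finite for all $u\in U$. $X_1,X_2,\dots$ are independent random vectors distributed as $X$. Let $\theta=\min_{u\in U}\mathbb{E}[F(u,X)]$, let $\theta_{SAA}^{(N)}=\min_{u\in U}\frac1N\sum_{i=1}^NF(u,X_i)$, and, for a bandwidth $h_N>0$, let $$\theta_K^{(N)}=\min_{u\in U}\frac1N\sum_{i=1}^N\int_{\mathbb{R}^m}F(u,x)K\Big(\frac{x-X_i}{h_N}\Big)\frac1{h_N^m}\,dx .$$ The minima are assumed attained and the expectations appearing well defined. Standing assumption: the bias $\mathbb{E}[\theta_{SAA}^{(N)}]-\theta$ is strictly negative. (k1): $K$ is a probability density with respect to Lebesgue measure on $\mathbb{R}^m$, symmetric around zero in the sense that $\int_{\mathbb{R}^m}y_lK(y)\,dy=0$ for $l=1,\dots,m$. (k2): $m_2(K)=\int_{\mathbb{R}^m}\|y\|^2K(y)\,dy$ is a finite positive number. *)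

theory Defs
  imports "HOL-Probability.Probability"
begin

text \<open>\<^const>\<open>has_bochner_integral\<close> and \<^const>\<open>integrable\<close> make existence of the
  integrals part of the conditions; with plain integrals it would be masked by the default value 0 of the integral of a non-integrable function.\<close>

definition k1 :: "(real^'m \<Rightarrow> real) \<Rightarrow> bool" where
  "k1 K \<longleftrightarrow> (\<forall>y. 0 \<le> K y) \<and> has_bochner_integral lborel K 1 \<and>
     (\<forall>l. has_bochner_integral lborel (\<lambda>y. y $ l * K y) 0)"

definition k2 :: "(real^'m \<Rightarrow> real) \<Rightarrow> bool" where
  "k2 K \<longleftrightarrow> integrable lborel (\<lambda>y. (norm y)\<^sup>2 * K y) \<and>
     0 < (\<integral>y. (norm y)\<^sup>2 * K y \<partial>lborel)"

definition min_attained :: "'a set \<Rightarrow> ('a \<Rightarrow> real) \<Rightarrow> bool" where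
  "min_attained U f \<longleftrightarrow> (\<exists>u. is_arg_min f (\<lambda>v. v \<in> U) u)"

text \<open>Meaningful only if the minimum is attained; \<^const>\<open>Least\<close> is otherwise unspecified.\<close>

definition minimum_on :: "'a set \<Rightarrow> ('a \<Rightarrow> real) \<Rightarrow> real" where
  "minimum_on U f = (LEAST t. t \<in> f ` U)"

text \<open>Observations are \<^term>\<open>Xs i\<close> for \<^term>\<open>i \<ge> (1::nat)\<close>; index 0 is unused.\<close>

definition saa_objective ::
  "('u \<Rightarrow> real^'m \<Rightarrow> real) \<Rightarrow> (nat \<Rightarrow> 'w \<Rightarrow> real^'m) \<Rightarrow> nat \<Rightarrow> 'w \<Rightarrow> 'u \<Rightarrow> real" where
  "saa_objective F Xs N w u = (1 / real N) * (\<Sum>i=1..N. F u (Xs i w))"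

definition kernel_objective ::
  "('u \<Rightarrow> real^'m \<Rightarrow> real) \<Rightarrow> (real^'m \<Rightarrow> real) \<Rightarrow> (nat \<Rightarrow> 'w \<Rightarrow> real^'m) \<Rightarrow>
   nat \<Rightarrow> real \<Rightarrow> 'w \<Rightarrow> 'u \<Rightarrow> real" where
  "kernel_objective F K Xs N h w u = (1 / real N) *
     (\<Sum>i=1..N. \<integral>x. F u x * K ((1 / h) *\<^sub>R (x - Xs i w)) * (1 / h ^ CARD('m)) \<partial>lborel)"

definition theta :: "'w measure \<Rightarrow> 'u set \<Rightarrow> ('u \<Rightarrow> real^'m \<Rightarrow> real) \<Rightarrow> ('w \<Rightarrow> real^'m) \<Rightarrow> real" where
  "theta M U F X = minimum_on U (\<lambda>u. \<integral>w. F u (X w) \<partial>M)"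

definition theta_SAA ::
  "'u set \<Rightarrow> ('u \<Rightarrow> real^'m \<Rightarrow> real) \<Rightarrow> (nat \<Rightarrow> 'w \<Rightarrow> real^'m) \<Rightarrow> nat \<Rightarrow> 'w \<Rightarrow> real" where
  "theta_SAA U F Xs N w = minimum_on U (saa_objective F Xs N w)"

definition theta_K ::
  "'u set \<Rightarrow> ('u \<Rightarrow> real^'m \<Rightarrow> real) \<Rightarrow> (real^'m \<Rightarrow> real) \<Rightarrow> (nat \<Rightarrow> 'w \<Rightarrow> real^'m) \<Rightarrow>
   nat \<Rightarrow> real \<Rightarrow> 'w \<Rightarrow> real" where
  "theta_K U F K Xs N h w = minimum_on U (kernel_objective F K Xs N h w)"

text \<open>The root mean square $(\mathbb{E}[Y^2])^{1/2}$ as an element of $[0,\infty]$, so that it is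
  defined also when the second moment is infinite.\<close>

definition rms :: "'w measure \<Rightarrow> ('w \<Rightarrow> real) \<Rightarrow> ennreal" where
  "rms M Y = (let I = \<integral>\<^sup>+w. ennreal ((Y w)\<^sup>2) \<partial>M in
     if I = \<infinity> then \<infinity> else ennreal (sqrt (enn2real I)))"

end

theory Submission
  imports Defs
begin

text \<open>A first-order Taylor expansion of \<open>F u\<close> around an observation, with a remainder controlled by the
  modulus of continuity of the gradient, shows that, since the first moment
  of the kernel vanishes, smoothing changes the objective by at most a constant times
  \<open>h powr (1 + \<alpha>)\<close>, uniformly in \<open>u\<close> and in the observations. The minima therefore differ by at
  most this amount, and all four estimates are consequences of the triangle inequality.\<close>

section \<open>First-order expansion and smoothing with a centred kernel\<close>

text \<open>Mean value inequality for \<open>f\<close> minus the linear functional given by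
  \<open>g x\<close>, on the ball of radius \<open>norm z\<close> around \<open>x\<close>: it is
  convex, contains \<open>x + z\<close>, and the derivative there is at most \<open>B\<close>.
  Restricting the hypothesis to this ball allows \<open>B\<close> to depend on \<open>z\<close>, as
  a modulus of continuity requires.\<close>

lemma taylor_remainder_bound:
  fixes f :: "'a::real_inner \<Rightarrow> real" and g :: "'a \<Rightarrow> 'a"
  assumes deriv: "\<And>y. GDERIV f y :> g y"
    and bound: "\<And>y. norm y \<le> norm z \<Longrightarrow> norm (g (x + y) - g x) \<le> B"
  shows "\<bar>f (x + z) - f x - g x \<bullet> z\<bar> \<le> B * norm z"
proof -
  have B: "0 \<le> B" using bound[of 0] by simp
  have "norm ((f (x + z) - g x \<bullet> (x + z)) - (f x - g x \<bullet> x)) \<le> B * norm ((x + z) - x)"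
  proof (rule differentiable_bound[where S = "cball x (norm z)"
        and f = "\<lambda>y. f y - g x \<bullet> y" and f' = "\<lambda>y d. (g y - g x) \<bullet> d"])
    fix y assume y: "y \<in> cball x (norm z)"
    have "(f has_derivative (\<lambda>d. d \<bullet> g y)) (at y)"
      using deriv by (simp add: gderiv_def)
    then have "((\<lambda>y. f y - g x \<bullet> y) has_derivative (\<lambda>d. d \<bullet> g y - g x \<bullet> d)) (at y)"
      by (intro derivative_intros)
    then show "((\<lambda>y. f y - g x \<bullet> y) has_derivative (\<lambda>d. (g y - g x) \<bullet> d))
        (at y within cball x (norm z))"
      by (rule has_derivative_at_withinI[THEN has_derivative_eq_rhs]) (simp add: inner_diff_right inner_commute)
    have "norm (g y - g x) \<le> B"
      using bound[of "y - x"] y by (simp add: dist_norm norm_minus_commute)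
    then have "norm (g y - g x) * norm d \<le> B * norm d" for d
      by (rule mult_right_mono) simp
    then have "norm ((g y - g x) \<bullet> d) \<le> B * norm d" for d
      using Cauchy_Schwarz_ineq2[of "g y - g x" d] unfolding real_norm_def by (rule order_trans[rotated])
    then show "onorm (\<lambda>d. (g y - g x) \<bullet> d) \<le> B"
      by (rule onorm_bound[rotated]) (use B in blast)
  qed (simp_all add: dist_norm)
  then show ?thesis
    by (simp add: inner_add_right diff_diff_eq add.commute)
qed

text \<open>The Jacobian of the substitution stays inside the integral, where it cancels the
  normalization \<open>1 / h ^ CARD('m)\<close> of the scaled kernel.\<close>

lemma integral_scale_shift:
  fixes G :: "'a::euclidean_space \<Rightarrow> real"
  assumes [measurable]: "G \<in> borel_measurable borel" and h: "h > 0"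
  shows "(\<integral>x. G x \<partial>lborel) = (\<integral>y. h ^ DIM('a) * G (\<xi> + h *\<^sub>R y) \<partial>lborel)"
proof -
  have "(\<integral>x. G x \<partial>lborel)
      = (\<integral>x. G x \<partial>density (distr lborel borel (\<lambda>x. \<xi> + h *\<^sub>R x)) (\<lambda>_. ennreal (\<bar>h\<bar> ^ DIM('a))))"
    using lborel_affine[of h \<xi>] h by simp
  also have "\<dots> = (\<integral>y. h ^ DIM('a) * G (\<xi> + h *\<^sub>R y) \<partial>lborel)"
    using h by (subst integral_density) (auto simp: integral_distr)
  finally show ?thesis .
qed

text \<open>Linearity extends the coordinatewise condition in \<open>k1\<close> to every linear
  functional; this is what removes the gradient term of the expansion.\<close>

lemma k1_inner_integral:
  fixes K :: "real^'m \<Rightarrow> real"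
  assumes "k1 K"
  shows "has_bochner_integral lborel (\<lambda>y. (v \<bullet> y) * K y) 0"
proof -
  have "has_bochner_integral lborel (\<lambda>y. \<Sum>i\<in>UNIV. v $ i * (y $ i * K y)) (\<Sum>i\<in>(UNIV::'m set). v $ i * 0)"
    using assms by (intro has_bochner_integral_sum has_bochner_integral_mult_right) (auto simp: k1_def)
  then show ?thesis
    by (simp add: inner_vec_def sum_distrib_right mult.assoc)
qed

text \<open>After substitution the constant part integrates to \<open>f \<xi>\<close>, because
  \<open>K\<close> has mass one, and the linear part to 0, so only the remainder contributes. A
  remainder of order \<open>1 + (norm y)\<^sup>2\<close> is integrable against \<open>K\<close> by
  \<open>k1\<close> and \<open>k2\<close>.\<close>

lemma kernel_smoothing_bound:
  fixes K :: "real^'m \<Rightarrow> real" and f :: "real^'m \<Rightarrow> real" and v :: "real^'m"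
  assumes K: "k1 K" "k2 K" and h: "h > 0"
    and [measurable]: "f \<in> borel_measurable borel"
    and bound: "\<And>y. \<bar>f (\<xi> + h *\<^sub>R y) - f \<xi> - v \<bullet> y\<bar> \<le> c * (1 + (norm y)\<^sup>2)"
  shows "\<bar>(\<integral>x. f x * K ((1 / h) *\<^sub>R (x - \<xi>)) * (1 / h ^ CARD('m)) \<partial>lborel) - f \<xi>\<bar>
    \<le> c * (1 + (\<integral>y. (norm y)\<^sup>2 * K y \<partial>lborel))"
proof -
  have K_nonneg: "0 \<le> K y" for y using K by (simp add: k1_def)
  have K_int: "has_bochner_integral lborel K 1" using K by (simp add: k1_def)
  then have [measurable]: "K \<in> borel_measurable borel"
    by (auto dest: borel_measurable_has_bochner_integral)
  have m2: "has_bochner_integral lborel (\<lambda>y. (norm y)\<^sup>2 * K y) (\<integral>y. (norm y)\<^sup>2 * K y \<partial>lborel)"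
    using K by (simp add: k2_def has_bochner_integral_integrable)
  define q where "q y = (f (\<xi> + h *\<^sub>R y) - f \<xi> - v \<bullet> y) * K y" for y
  have dom: "has_bochner_integral lborel (\<lambda>y. c * (K y + (norm y)\<^sup>2 * K y))
      (c * (1 + (\<integral>y. (norm y)\<^sup>2 * K y \<partial>lborel)))"
    by (intro has_bochner_integral_mult_right has_bochner_integral_add K_int m2)
  have q_le: "norm (q y) \<le> c * (K y + (norm y)\<^sup>2 * K y)" for y
    using mult_right_mono[OF bound[of y] K_nonneg[of y]] K_nonneg[of y]
    by (simp add: q_def abs_mult distrib_left distrib_right mult_ac)
  have q_int: "integrable lborel q"
  proof (rule Bochner_Integration.integrable_bound)
    show "q \<in> borel_measurable lborel" unfolding q_def[abs_def] by measurable
    show "AE y in lborel. norm (q y) \<le> norm (c * (K y + (norm y)\<^sup>2 * K y))"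
      by (rule AE_I2, rule order_trans[OF q_le]) auto
  qed (rule integrable.intros[OF dom])
  \<comment> \<open>Reassembling the integrand from remainder, constant and linear part yields its
    integrability and its integral at once.\<close>
  have "has_bochner_integral lborel (\<lambda>y. q y + f \<xi> * K y + (v \<bullet> y) * K y)
      ((\<integral>y. q y \<partial>lborel) + f \<xi> * 1 + 0)"
    by (intro has_bochner_integral_add has_bochner_integral_mult_right K_int
        k1_inner_integral[OF K(1)] has_bochner_integral_integrable q_int)
  then have "has_bochner_integral lborel (\<lambda>y. f (\<xi> + h *\<^sub>R y) * K y) ((\<integral>y. q y \<partial>lborel) + f \<xi>)"
    by (simp add: q_def algebra_simps)
  then have "(\<integral>y. f (\<xi> + h *\<^sub>R y) * K y \<partial>lborel) = (\<integral>y. q y \<partial>lborel) + f \<xi>"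
    by (rule has_bochner_integral_integral_eq)
  moreover have "(\<integral>x. f x * K ((1 / h) *\<^sub>R (x - \<xi>)) * (1 / h ^ CARD('m)) \<partial>lborel)
      = (\<integral>y. f (\<xi> + h *\<^sub>R y) * K y \<partial>lborel)"
    using h by (subst integral_scale_shift[OF _ h, where \<xi> = \<xi>]) (auto intro!: Bochner_Integration.integral_cong)
  moreover have "norm (\<integral>y. q y \<partial>lborel) \<le> (\<integral>y. c * (K y + (norm y)\<^sup>2 * K y) \<partial>lborel)"
    by (rule Bochner_Integration.integral_norm_bound_integral[OF q_int integrable.intros[OF dom] q_le])
  ultimately show ?thesis
    unfolding has_bochner_integral_integral_eq[OF dom] by simp
qed

text \<open>For \<open>t\<close> at most 1 the product \<open>t powr a * t\<close> is at most 1, and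
  beyond 1 it is at most the square of \<open>t\<close>. Since \<open>h\<close> is below 1, lowering
  the exponent from \<open>a\<close> to \<open>\<alpha>\<close> only increases the power of
  \<open>h\<close>; thus several exponents merge into one rate.\<close>

lemma powr_scale_bound:
  fixes h t a \<alpha> :: real
  assumes "0 < h" "h < 1" "0 \<le> t" "0 < a" "a \<le> 1" "\<alpha> \<le> a"
  shows "(h * t) powr a * (h * t) \<le> h powr (1 + \<alpha>) * (1 + t\<^sup>2)"
proof -
  have "t powr a * t \<le> 1 + t\<^sup>2"
  proof (cases "t \<le> 1")
    case True
    then have "t powr a * t \<le> 1 * 1"
      using assms by (intro mult_mono powr_le1) auto
    then show ?thesis by (smt (verit) zero_le_power2)
  next
    case False
    then have "t powr a \<le> t powr 1" using assms by (intro powr_mono) auto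
    then have "t powr a * t \<le> t * t" using False by (intro mult_right_mono) auto
    then show ?thesis by (simp add: power2_eq_square)
  qed
  moreover have "h powr (1 + a) \<le> h powr (1 + \<alpha>)"
    using assms by (intro powr_mono') auto
  ultimately have "h powr (1 + a) * (t powr a * t) \<le> h powr (1 + \<alpha>) * (1 + t\<^sup>2)"
    using assms by (intro mult_mono) auto
  then show ?thesis
    using assms by (simp add: powr_mult powr_add mult_ac)
qed

section \<open>Stability of minima and of root mean squares\<close>

text \<open>Each minimizer is tested in the other objective. Attainment identifies the
  \<open>Least\<close> in \<open>minimum_on\<close> with the value at a minimizer.\<close>

lemma minimum_on_diff_le:
  assumes "min_attained U f" "min_attained U g"
    and close: "\<And>u. u \<in> U \<Longrightarrow> \<bar>f u - g u\<bar> \<le> d"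
  shows "\<bar>minimum_on U f - minimum_on U g\<bar> \<le> d"
proof -
  have eq: "\<exists>u\<in>U. minimum_on U k = k u \<and> (\<forall>v\<in>U. k u \<le> k v)" if att: "min_attained U k" for k :: "'a \<Rightarrow> real"
  proof -
    obtain u where u: "u \<in> U" "\<forall>v\<in>U. k u \<le> k v"
      using att by (auto simp: min_attained_def is_arg_min_linorder)
    moreover have "minimum_on U k = k u"
      unfolding minimum_on_def by (rule Least_equality) (use u in auto)
    ultimately show ?thesis by blast
  qed
  obtain u where u: "u \<in> U" "minimum_on U f = f u" "\<forall>w\<in>U. f u \<le> f w"
    using eq[OF assms(1)] by blast
  obtain v where v: "v \<in> U" "minimum_on U g = g v" "\<forall>w\<in>U. g v \<le> g w"
    using eq[OF assms(2)] by blast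
  have "f u \<le> f v" "g v \<le> g u" using u v by auto
  then show ?thesis
    using close[OF u(1)] close[OF v(1)] unfolding u(2) v(2) by linarith
qed

text \<open>Minkowski's inequality with a constant as second summand: expanding the square of
  \<open>\<bar>Z w\<bar> + c\<close>, the cross term is controlled because the mean of
  \<open>\<bar>Z w\<bar>\<close> is at most its root mean square \<open>s\<close>. If the second
  moment of \<open>Z\<close> is infinite, so is the right-hand side.\<close>

lemma (in prob_space) rms_triangle:
  assumes [measurable]: "Z \<in> borel_measurable M"
    and le: "AE w in M. \<bar>Y w\<bar> \<le> \<bar>Z w\<bar> + c" and c: "0 \<le> c"
  shows "rms M Y \<le> rms M Z + ennreal c"
proof (cases "(\<integral>\<^sup>+w. ennreal ((Z w)\<^sup>2) \<partial>M) = \<infinity>")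
  case True
  then show ?thesis by (simp add: rms_def)
next
  case False
  have Z2: "integrable M (\<lambda>w. (Z w)\<^sup>2)"
    using False by (intro integrableI_bounded) (auto simp: less_top)
  have Z1: "integrable M (\<lambda>w. \<bar>Z w\<bar>)"
    using square_integrable_imp_integrable[OF _ Z2] by simp
  define s where "s = sqrt (expectation (\<lambda>w. (Z w)\<^sup>2))"
  have s: "0 \<le> s" "s\<^sup>2 = expectation (\<lambda>w. (Z w)\<^sup>2)" by (auto simp: s_def)
  have Z_nn: "(\<integral>\<^sup>+w. ennreal ((Z w)\<^sup>2) \<partial>M) = ennreal (s\<^sup>2)"
    unfolding s(2) by (rule nn_integral_eq_integral[OF Z2]) auto
  then have rms_Z: "rms M Z = ennreal s" using s(1) by (simp add: rms_def)
  \<comment> \<open>This is nonnegativity of the variance of \<open>\<bar>Z w\<bar>\<close>.\<close>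
  have "(expectation (\<lambda>w. \<bar>Z w\<bar>))\<^sup>2 \<le> s\<^sup>2"
    using variance_positive[of "\<lambda>w. \<bar>Z w\<bar>"] variance_eq[OF Z1] Z2 by (simp add: s(2))
  then have mean: "expectation (\<lambda>w. \<bar>Z w\<bar>) \<le> s" using s(1) by (rule power2_le_imp_le)
  have "(\<integral>\<^sup>+w. ennreal ((Y w)\<^sup>2) \<partial>M) \<le> (\<integral>\<^sup>+w. ennreal ((Z w)\<^sup>2 + 2 * c * \<bar>Z w\<bar> + c\<^sup>2) \<partial>M)"
  proof (rule nn_integral_mono_AE)
    show "AE w in M. ennreal ((Y w)\<^sup>2) \<le> ennreal ((Z w)\<^sup>2 + 2 * c * \<bar>Z w\<bar> + c\<^sup>2)"
      using le
    proof eventually_elim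
      case (elim w)
      then have "\<bar>Y w\<bar>\<^sup>2 \<le> (\<bar>Z w\<bar> + c)\<^sup>2" by (intro power_mono) auto
      then show ?case by (intro ennreal_leI) (simp add: power2_sum mult_ac)
    qed
  qed
  also have "\<dots> = ennreal (expectation (\<lambda>w. (Z w)\<^sup>2 + 2 * c * \<bar>Z w\<bar> + c\<^sup>2))"
    using Z1 Z2 c by (intro nn_integral_eq_integral) auto
  also have "expectation (\<lambda>w. (Z w)\<^sup>2 + 2 * c * \<bar>Z w\<bar> + c\<^sup>2) = s\<^sup>2 + 2 * c * expectation (\<lambda>w. \<bar>Z w\<bar>) + c\<^sup>2"
    using Z1 Z2 by (simp add: s(2) prob_space)
  also have "\<dots> \<le> (s + c)\<^sup>2"
    using mult_left_mono[OF mean, of "2 * c"] c by (simp add: power2_sum algebra_simps)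
  finally have Y_le: "(\<integral>\<^sup>+w. ennreal ((Y w)\<^sup>2) \<partial>M) \<le> ennreal ((s + c)\<^sup>2)" by (simp add: ennreal_leI)
  \<comment> \<open>Finiteness selects the branch of \<open>rms\<close> with the square root;
    \<open>enn2real\<close> alone would send infinity to 0.\<close>
  then have "(\<integral>\<^sup>+w. ennreal ((Y w)\<^sup>2) \<partial>M) \<noteq> \<infinity>" by (auto simp: top_unique)
  moreover have "sqrt (enn2real (\<integral>\<^sup>+w. ennreal ((Y w)\<^sup>2) \<partial>M)) \<le> s + c"
    using enn2real_leI[OF _ Y_le] s(1) c by (intro real_le_lsqrt) auto
  ultimately show ?thesis
    using s(1) c unfolding rms_Z by (simp add: rms_def ennreal_leI flip: ennreal_plus)
qed

section \<open>Uniform smoothing error and the four estimates\<close>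

theorem theorem8:
  fixes M :: "'w measure"
    and U :: "(real^'n) set"
    and X :: "'w \<Rightarrow> real^'m"
    and Xs :: "nat \<Rightarrow> 'w \<Rightarrow> real^'m"
    and F :: "real^'n \<Rightarrow> real^'m \<Rightarrow> real"
    and gradF :: "real^'n \<Rightarrow> real^'m \<Rightarrow> real^'m"
    and K :: "real^'m \<Rightarrow> real"
    and l :: nat
    and L\<^sub>0 a :: "nat \<Rightarrow> real"
  assumes prob: "prob_space M"
    and U: "U \<noteq> {}" "closed U"
    and X_integrable: "integrable M X"
    and F_integrable: "\<And>u. u \<in> U \<Longrightarrow> integrable M (\<lambda>w. F u (X w))"
    and indep: "prob_space.indep_vars M (\<lambda>_. borel) Xs {1..}"
    and ident: "\<And>i. i \<ge> 1 \<Longrightarrow> distr M borel (Xs i) = distr M borel X"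
    and theta_attained: "min_attained U (\<lambda>u. \<integral>w. F u (X w) \<partial>M)"
    and SAA_attained: "\<And>N. N \<ge> 1 \<Longrightarrow> AE w in M. min_attained U (saa_objective F Xs N w)"
    and SAA_integrable: "\<And>N. N \<ge> 1 \<Longrightarrow> integrable M (theta_SAA U F Xs N)"
    and SAA_bias: "\<And>N. N \<ge> 1 \<Longrightarrow> (\<integral>w. theta_SAA U F Xs N w \<partial>M) - theta M U F X < 0"
    and kernel: "k1 K" "k2 K"
    and gradient: "\<And>u x. u \<in> U \<Longrightarrow> GDERIV (F u) x :> gradF u x"
    and gradient_cont: "\<And>u. u \<in> U \<Longrightarrow> continuous_on UNIV (gradF u)"
    and l: "l \<ge> 1"
    and L\<^sub>0: "\<And>j. j \<in> {1..l} \<Longrightarrow> 0 \<le> L\<^sub>0 j"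
    and a: "\<And>j. j \<in> {1..l} \<Longrightarrow> 0 < a j \<and> a j \<le> 1"
    and modulus: "\<And>u x y. u \<in> U \<Longrightarrow>
      norm (gradF u (x + y) - gradF u x) \<le> (\<Sum>j=1..l. L\<^sub>0 j * norm y powr a j)"
  shows "\<exists>\<alpha> L :: real. 0 < \<alpha> \<and> \<alpha> \<le> 1 \<and> 0 < L \<and>
    (\<forall>(N::nat) (h::real). 1 \<le> N \<longrightarrow> 0 < h \<longrightarrow> h < 1 \<longrightarrow>
       (AE w in M. min_attained U (kernel_objective F K Xs N h w)) \<longrightarrow>
       integrable M (theta_K U F K Xs N h) \<longrightarrow>
       (let \<theta> = theta M U F X;
            \<theta>S = theta_SAA U F Xs N; ES = (\<integral>w. \<theta>S w \<partial>M);
            \<theta>K = theta_K U F K Xs N h; EK = (\<integral>w. \<theta>K w \<partial>M)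
        in (AE w in M. \<bar>\<theta>K w - \<theta>\<bar> \<le> \<bar>\<theta>S w - \<theta>\<bar> + L * h powr (1 + \<alpha>)) \<and>
           \<bar>EK - \<theta>\<bar> \<le> \<bar>ES - \<theta>\<bar> + L * h powr (1 + \<alpha>) \<and>
           rms M (\<lambda>w. \<theta>K w - EK) \<le> rms M (\<lambda>w. \<theta>S w - ES) + ennreal (2 * L * h powr (1 + \<alpha>)) \<and>
           rms M (\<lambda>w. \<theta>K w - \<theta>) \<le> rms M (\<lambda>w. \<theta>S w - \<theta>) + ennreal (L * h powr (1 + \<alpha>))))"
proof -
  interpret prob_space M by (rule prob)
  define m2 where "m2 = (\<integral>y. (norm y)\<^sup>2 * K y \<partial>lborel)"
  \<comment> \<open>For \<open>h\<close> below 1 the smallest exponent gives the largest power of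
    \<open>h\<close>, hence a common bound for all terms of the modulus.\<close>
  define \<alpha> where "\<alpha> = Min (a ` {1..l})"
  \<comment> \<open>The factor \<open>1 + m2\<close> is the integral of
    \<open>1 + (norm y)\<^sup>2\<close> against the kernel; the final 1 keeps \<open>L\<close>
    positive when all \<open>L\<^sub>0 j\<close> vanish.\<close>
  define L where "L = (\<Sum>j=1..l. L\<^sub>0 j) * (1 + m2) + 1"
  have \<alpha>_le: "\<alpha> \<le> a j" if "j \<in> {1..l}" for j
    unfolding \<alpha>_def using that by (intro Min_le) auto
  have "\<alpha> \<in> a ` {1..l}" unfolding \<alpha>_def using l by (intro Min_in) auto
  then have \<alpha>: "0 < \<alpha>" "\<alpha> \<le> 1" using a by auto
  have m2: "0 < m2" using kernel by (simp add: k2_def m2_def)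
  have sum_nonneg_L: "0 \<le> (\<Sum>j=1..l. L\<^sub>0 j)" using L\<^sub>0 by (intro sum_nonneg)
  have L: "0 < L" using sum_nonneg_L m2 by (auto simp: L_def intro!: add_nonneg_pos mult_nonneg_nonneg)
  \<comment> \<open>The bound is deterministic and uniform in \<open>\<xi>\<close>, so any
    observation \<open>Xs i w\<close> may be inserted for \<open>\<xi>\<close>.\<close>
  have smooth: "\<bar>(\<integral>x. F u x * K ((1 / h) *\<^sub>R (x - \<xi>)) * (1 / h ^ CARD('m)) \<partial>lborel) - F u \<xi>\<bar>
      \<le> L * h powr (1 + \<alpha>)" if u: "u \<in> U" and h: "0 < h" "h < 1" for u \<xi> h
  proof -
    have "continuous_on UNIV (F u)"
      using gradient[OF u] by (auto simp: gderiv_def intro!: continuous_at_imp_continuous_on has_derivative_continuous)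
    then have meas: "F u \<in> borel_measurable borel" by (rule borel_measurable_continuous_onI)
    define c where "c = (\<Sum>j=1..l. L\<^sub>0 j) * h powr (1 + \<alpha>)"
    \<comment> \<open>In the rescaled variable the vector \<open>v\<close> of
      \<open>kernel_smoothing_bound\<close> is \<open>h\<close> times the gradient at
      \<open>\<xi>\<close>.\<close>
    have "\<bar>F u (\<xi> + h *\<^sub>R y) - F u \<xi> - (h *\<^sub>R gradF u \<xi>) \<bullet> y\<bar> \<le> c * (1 + (norm y)\<^sup>2)" for y
    proof -
      have "\<bar>F u (\<xi> + h *\<^sub>R y) - F u \<xi> - gradF u \<xi> \<bullet> (h *\<^sub>R y)\<bar>
          \<le> (\<Sum>j=1..l. L\<^sub>0 j * norm (h *\<^sub>R y) powr a j) * norm (h *\<^sub>R y)"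
      proof (rule taylor_remainder_bound[OF gradient[OF u]])
        fix z :: "real^'m" assume z: "norm z \<le> norm (h *\<^sub>R y)"
        \<comment> \<open>The modulus increases with the norm, so its value at the radius serves as
          \<open>B\<close> on the whole ball.\<close>
        have "norm z powr a j \<le> norm (h *\<^sub>R y) powr a j" if "j \<in> {1..l}" for j
          using a[OF that] z by (intro powr_mono2) auto
        then have "(\<Sum>j=1..l. L\<^sub>0 j * norm z powr a j) \<le> (\<Sum>j=1..l. L\<^sub>0 j * norm (h *\<^sub>R y) powr a j)"
          using L\<^sub>0 by (intro sum_mono mult_left_mono) auto
        then show "norm (gradF u (\<xi> + z) - gradF u \<xi>) \<le> (\<Sum>j=1..l. L\<^sub>0 j * norm (h *\<^sub>R y) powr a j)"
          using modulus[OF u, of \<xi> z] by linarith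
      qed
      also have "\<dots> = (\<Sum>j=1..l. L\<^sub>0 j * ((h * norm y) powr a j * (h * norm y)))"
        using h by (simp add: sum_distrib_right mult.assoc)
      also have "\<dots> \<le> (\<Sum>j=1..l. L\<^sub>0 j * (h powr (1 + \<alpha>) * (1 + (norm y)\<^sup>2)))"
        using h a L\<^sub>0 \<alpha>_le by (intro sum_mono mult_left_mono powr_scale_bound) auto
      finally show ?thesis by (simp add: c_def sum_distrib_right mult.assoc)
    qed
    from kernel_smoothing_bound[OF kernel h(1) meas this]
    have "\<bar>(\<integral>x. F u x * K ((1 / h) *\<^sub>R (x - \<xi>)) * (1 / h ^ CARD('m)) \<partial>lborel) - F u \<xi>\<bar> \<le> c * (1 + m2)"
      by (simp add: m2_def)
    also have "c * (1 + m2) \<le> L * h powr (1 + \<alpha>)"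
      by (simp add: c_def L_def algebra_simps)
    finally show ?thesis .
  qed
  \<comment> \<open>Averaging \<open>N\<close> errors with a common bound preserves that bound, so
    it depends neither on \<open>N\<close> nor on \<open>u\<close>.\<close>
  have objective: "\<bar>kernel_objective F K Xs N h w u - saa_objective F Xs N w u\<bar> \<le> L * h powr (1 + \<alpha>)"
    if "u \<in> U" "0 < h" "h < 1" "1 \<le> N" for u h w and N :: nat
  proof -
    have "\<bar>\<Sum>i=1..N. (\<integral>x. F u x * K ((1 / h) *\<^sub>R (x - Xs i w)) * (1 / h ^ CARD('m)) \<partial>lborel) - F u (Xs i w)\<bar>
        \<le> real N * (L * h powr (1 + \<alpha>))"
      using smooth[OF that(1-3)] sum_norm_bound[of "{1..N}"
          "\<lambda>i. (\<integral>x. F u x * K ((1 / h) *\<^sub>R (x - Xs i w)) * (1 / h ^ CARD('m)) \<partial>lborel) - F u (Xs i w)"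
          "L * h powr (1 + \<alpha>)"] by simp
    then have "\<bar>(1 / real N) * (\<Sum>i=1..N. (\<integral>x. F u x * K ((1 / h) *\<^sub>R (x - Xs i w)) * (1 / h ^ CARD('m)) \<partial>lborel) - F u (Xs i w))\<bar>
        \<le> L * h powr (1 + \<alpha>)"
      using that(4) by (simp only: abs_mult) (simp add: field_simps)
    then show ?thesis
      by (simp only: kernel_objective_def saa_objective_def sum_subtractf right_diff_distrib)
  qed
  show ?thesis
  proof (rule exI[of _ \<alpha>], rule exI[of _ L], intro conjI allI impI \<alpha> L)
    fix N :: nat and h :: real
    assume N: "1 \<le> N" and h: "0 < h" "h < 1"
      and att: "AE w in M. min_attained U (kernel_objective F K Xs N h w)"
      and K_int: "integrable M (theta_K U F K Xs N h)"
    define \<theta> where "\<theta> = theta M U F X"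
    define S where "S = theta_SAA U F Xs N"
    define T where "T = theta_K U F K Xs N h"
    define d where "d = L * h powr (1 + \<alpha>)"
    have d: "0 \<le> d" using L by (simp add: d_def)
    have ints[simp]: "integrable M S" "integrable M T"
      using SAA_integrable[OF N] K_int by (auto simp: S_def T_def)
    have meas[measurable]: "S \<in> borel_measurable M"
      using ints(1) by (rule borel_measurable_integrable)
    \<comment> \<open>The exceptional null set comes only from the attainment of the two minima,
      which is assumed almost surely.\<close>
    have close: "AE w in M. \<bar>T w - S w\<bar> \<le> d"
      using att SAA_attained[OF N]
    proof eventually_elim
      case (elim w)
      then show ?case
        unfolding T_def S_def theta_K_def theta_SAA_def d_def
        using objective[OF _ h N] by (intro minimum_on_diff_le) auto
    qed
    have "\<bar>expectation T - expectation S\<bar> = \<bar>expectation (\<lambda>w. T w - S w)\<bar>" by simp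
    also have "\<dots> \<le> expectation (\<lambda>w. \<bar>T w - S w\<bar>)" by (rule integral_abs_bound)
    also have "\<dots> \<le> expectation (\<lambda>w. d)"
      using close by (intro integral_mono_AE) auto
    finally have mean: "\<bar>expectation T - expectation S\<bar> \<le> d" by (simp add: prob_space)
    have pointwise: "AE w in M. \<bar>T w - \<theta>\<bar> \<le> \<bar>S w - \<theta>\<bar> + d"
      using close by eventually_elim linarith
    \<comment> \<open>One \<open>d\<close> pays for replacing \<open>T w\<close> by
      \<open>S w\<close>, the other for replacing the mean.\<close>
    have centered: "AE w in M. \<bar>T w - expectation T\<bar> \<le> \<bar>S w - expectation S\<bar> + 2 * d"
      using close by eventually_elim (use mean in linarith)
    have "rms M (\<lambda>w. T w - expectation T) \<le> rms M (\<lambda>w. S w - expectation S) + ennreal (2 * d)"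
      by (rule rms_triangle[OF _ centered]) (use d in auto)
    moreover have "rms M (\<lambda>w. T w - \<theta>) \<le> rms M (\<lambda>w. S w - \<theta>) + ennreal d"
      by (rule rms_triangle[OF _ pointwise]) (use d in auto)
    moreover have "\<bar>expectation T - \<theta>\<bar> \<le> \<bar>expectation S - \<theta>\<bar> + d"
      using mean by linarith
    ultimately show "let \<theta> = theta M U F X;
            \<theta>S = theta_SAA U F Xs N; ES = (\<integral>w. \<theta>S w \<partial>M);
            \<theta>K = theta_K U F K Xs N h; EK = (\<integral>w. \<theta>K w \<partial>M)
        in (AE w in M. \<bar>\<theta>K w - \<theta>\<bar> \<le> \<bar>\<theta>S w - \<theta>\<bar> + L * h powr (1 + \<alpha>)) \<and>
           \<bar>EK - \<theta>\<bar> \<le> \<bar>ES - \<theta>\<bar> + L * h powr (1 + \<alpha>) \<and>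
           rms M (\<lambda>w. \<theta>K w - EK) \<le> rms M (\<lambda>w. \<theta>S w - ES) + ennreal (2 * L * h powr (1 + \<alpha>)) \<and>
           rms M (\<lambda>w. \<theta>K w - \<theta>) \<le> rms M (\<lambda>w. \<theta>S w - \<theta>) + ennreal (L * h powr (1 + \<alpha>))"
      using pointwise unfolding Let_def \<theta>_def S_def T_def d_def by (simp only: mult.assoc simp_thms)
  qed
qed

end
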